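(* Let $A$ be a Hopf algebra over a field $\Bbbk$ with comultiplication $\Delta$, counit $\varepsilon$ and bijective antipode $S$. Let $\theta_{ij},\chi_i:A\to\Bbbk$, $i,j=1,\ldots,n$, be $\Bbbk$-linear maps such that for all $a,b\in A$ $$\theta_{ij}(ab)=\sum_k\theta_{ik}(a)\theta_{kj}(b),\qquad \theta_{ij}(1)=\delta_{ij},\qquad \chi_i(ab)=\sum_j\chi_j(a)\theta_{ji}(b)+\varepsilon(a)\chi_i(b).$$ Let $(\partial,\sigma;\bar\sigma,\hat\sigma)$ be the free right twisted multi-derivation on $A$ given by $$\partial_i(a)=\chi_i\triangleright a,\quad \sigma_{ij}(a)=\theta_{ij}\triangleright a,\quad \bar\sigma_{ij}(a)=(\theta_{ji}\circ S^{-1})\triangleright a,\quad \hat\sigma_{ij}(a)=(\theta_{ij}\circ S^{-2})\triangleright a,$$ where $f\triangleright a=(\mathrm{id}\otimes f)(\Delta(a))$ for $f\in\mathrm{Hom}_\Bbbk(A,\Bbbk)$, and let $\Lambda$ be the integral on $A$ relative to $(\partial,\sigma;\bar\sigma,\hat\sigma)$. Then $$\Lambda\big((\chi_i\circ S^{-2})\triangleright a\big)=\Lambda\big(S^2(\partial_i(a))\big)=0$$ for all $a\in A$ and $i=1,2,\ldots,n$. Consequently, if $\lambda:A\to\Bbbk$ is a right integral on the Hopf algebra $A$, then, for all $a\in A$ and $i=1,\ldots,n$, $$\lambda\big((\chi_i\circ S^{-2})\triangleright a\big)=\lambda\big(S^2(\partial_i(a))\big)=0.$$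
   Context: A right integral on $A$ is a $\Bbbk$-linear map $\lambda:A\to\Bbbk$ with $(\lambda\otimes\mathrm{id})\circ\Delta(a)=\lambda(a)1$ for all $a\in A$. Free right twisted multi-derivation $(\partial,\sigma;\bar\sigma,\hat\sigma)$ on an algebra $A$: $\Bbbk$-linear maps $\partial=(\partial_i):A\to A^n$ and $\sigma=(\sigma_{ij}),\bar\sigma=(\bar\sigma_{ij}),\hat\sigma=(\hat\sigma_{ij}):A\to M_n(A)$ with $\sigma$ and $\bar\sigma$ (unital) algebra maps, $\partial_i(ab)=\sum_j\partial_j(a)\sigma_{ji}(b)+a\partial_i(b)$ for all $a,b\in A$, and, for all $a\in A$ and all $i,j$, $$\sum_k\bar\sigma_{ik}(\sigma_{jk}(a))=\delta_{ij}a,\quad \sum_k\sigma_{ki}(\bar\sigma_{kj}(a))=\delta_{ij}a,\quad \sum_k\hat\sigma_{ik}(\bar\sigma_{jk}(a))=\delta_{ij}a,\quad \sum_k\bar\sigma_{ki}(\hat\sigma_{kj}(a))=\delta_{ij}a.$$ (The maps in the claim satisfy these conditions.) The associated first order differential calculus $\Omega^1(A)$ is the free left $A$-module with basis $\omega_1,\ldots,\omega_n$, with right action determined by $\omega_i a=\sum_j\sigma_{ij}(a)\omega_j$, and differential $da=\sum_i\partial_i(a)\omega_i$. Put $\partial_i^\sigma:=\sum_{j,k}\bar\sigma_{kj}\circ\partial_j\circ\hat\sigma_{ki}$ and let $\mathrm{Hom}_A(\Omega^1(A),A)$ be the right $A$-module maps $\Omega^1(A)\to A$; define $$\nabla:\mathrm{Hom}_A(\Omega^1(A),A)\to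 A,\qquad f\mapsto\sum_i\partial_i^\sigma(f(\omega_i)).$$ The integral on $A$ relative to $(\partial,\sigma;\bar\sigma,\hat\sigma)$ is the cokernel map $\Lambda:A\to\mathrm{coker}\,\nabla=A/\mathrm{im}\,\nabla$. *)

theory Defs
  imports
    "HOL-Analysis.Finite_Cartesian_Product"
    "HOL-Library.Poly_Mapping"
    "HOL-Library.Set_Algebras"
begin

text \<open>
  A vector space over the field \<open>'k\<close> is a type \<open>'a\<close> together with a scalar multiplication
  \<open>s\<close>, as in the locale \<^locale>\<open>vector_space\<close>.  The type \<open>'x \<Rightarrow>\<^sub>0 'k\<close> is the free vector space
  on \<open>'x\<close>.  The spaces \<open>A \<otimes> A\<close> and \<open>A \<otimes> A \<otimes> A\<close> are the quotients of the free vector spaces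
  on \<open>A \<times> A\<close> and \<open>A \<times> A \<times> A\<close> by the multilinearity relations.  Since \<open>s\<close> is a term and not part
  of the type, the quotients are sets of cosets \<open>x +o N\<close> and not types.
\<close>

definition fscale :: "'k::field \<Rightarrow> ('x \<Rightarrow>\<^sub>0 'k) \<Rightarrow> ('x \<Rightarrow>\<^sub>0 'k)"
  where "fscale c = Poly_Mapping.map ((*) c)"

lemma lookup_fscale [simp]: "Poly_Mapping.lookup (fscale c x) p = c * Poly_Mapping.lookup x p"
  by (simp add: fscale_def map.rep_eq when_def)

interpretation free_space: vector_space "fscale :: 'k::field \<Rightarrow> ('x \<Rightarrow>\<^sub>0 'k) \<Rightarrow> ('x \<Rightarrow>\<^sub>0 'k)"
  by unfold_locales (auto intro!: poly_mapping_eqI simp: lookup_add algebra_simps)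

definition lin_extend :: "('k::field \<Rightarrow> 'v \<Rightarrow> 'v) \<Rightarrow> ('x \<Rightarrow> 'v) \<Rightarrow> ('x \<Rightarrow>\<^sub>0 'k) \<Rightarrow> 'v::ab_group_add"
  where "lin_extend s g (x :: 'x \<Rightarrow>\<^sub>0 'k) = (\<Sum>p\<in>Poly_Mapping.keys x. s (Poly_Mapping.lookup x p) (g p))"

abbreviation basis_elem :: "'x \<Rightarrow> ('x \<Rightarrow>\<^sub>0 'k::field)"
  where "basis_elem p \<equiv> Poly_Mapping.single p 1"

definition tensor2_null :: "('k::field \<Rightarrow> 'a \<Rightarrow> 'a) \<Rightarrow> ('a::ab_group_add \<times> 'a \<Rightarrow>\<^sub>0 'k) set"
  where "tensor2_null s = free_space.span
    ({basis_elem (a + b, c) - basis_elem (a, c) - basis_elem (b, c) | a b c. True} \<union>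
     {basis_elem (a, b + c) - basis_elem (a, b) - basis_elem (a, c) | a b c. True} \<union>
     {basis_elem (s t a, b) - fscale t (basis_elem (a, b)) | t a b. True} \<union>
     {basis_elem (a, s t b) - fscale t (basis_elem (a, b)) | t a b. True})"

definition tensor3_null :: "('k::field \<Rightarrow> 'a \<Rightarrow> 'a) \<Rightarrow> ('a::ab_group_add \<times> 'a \<times> 'a \<Rightarrow>\<^sub>0 'k) set"
  where "tensor3_null s = free_space.span
    ({basis_elem (a + b, c, d) - basis_elem (a, c, d) - basis_elem (b, c, d) | a b c d. True} \<union>
     {basis_elem (a, b + c, d) - basis_elem (a, b, d) - basis_elem (a, c, d) | a b c d. True} \<union>
     {basis_elem (a, b, c + d) - basis_elem (a, b, c) - basis_elem (a, b, d) | a b c d. True} \<union>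
     {basis_elem (s t a, b, c) - fscale t (basis_elem (a, b, c)) | t a b c. True} \<union>
     {basis_elem (a, s t b, c) - fscale t (basis_elem (a, b, c)) | t a b c. True} \<union>
     {basis_elem (a, b, s t c) - fscale t (basis_elem (a, b, c)) | t a b c. True})"

type_synonym ('a, 'k) tensor2 = "('a \<times> 'a \<Rightarrow>\<^sub>0 'k) set"
type_synonym ('a, 'k) tensor3 = "('a \<times> 'a \<times> 'a \<Rightarrow>\<^sub>0 'k) set"

definition tensor2_class :: "('k::field \<Rightarrow> 'a \<Rightarrow> 'a) \<Rightarrow> ('a \<times> 'a \<Rightarrow>\<^sub>0 'k) \<Rightarrow> ('a::ab_group_add, 'k) tensor2"
  where "tensor2_class s x = x +o tensor2_null s"

definition tensor3_class :: "('k::field \<Rightarrow> 'a \<Rightarrow> 'a) \<Rightarrow> ('a \<times> 'a \<times> 'a \<Rightarrow>\<^sub>0 'k) \<Rightarrow> ('a::ab_group_add, 'k) tensor3"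
  where "tensor3_class s x = x +o tensor3_null s"

definition tensor2_space :: "('k::field \<Rightarrow> 'a \<Rightarrow> 'a) \<Rightarrow> ('a::ab_group_add, 'k) tensor2 set"
  where "tensor2_space s = range (tensor2_class s)"

text \<open>
  Maps out of a tensor product are given on an arbitrary representative of the coset; the
  values do not depend on the choice whenever the data are (multi)linear, cf. the lemma
  \<open>tensor2_lift_class\<close>.
\<close>

definition rep :: "'x set \<Rightarrow> 'x"
  where "rep X = (SOME x. x \<in> X)"

definition tensor2_smult :: "('k::field \<Rightarrow> 'a \<Rightarrow> 'a) \<Rightarrow> 'k \<Rightarrow> ('a::ab_group_add, 'k) tensor2 \<Rightarrow> ('a, 'k) tensor2"
  where "tensor2_smult s t X = tensor2_class s (fscale t (rep X))"

definition tensor2_add :: "('k::field \<Rightarrow> 'a \<Rightarrow> 'a) \<Rightarrow> ('a::ab_group_add, 'k) tensor2 \<Rightarrow> ('a, 'k) tensor2 \<Rightarrow> ('a, 'k) tensor2"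
  where "tensor2_add s X Y = tensor2_class s (rep X + rep Y)"

definition tensor2_mult :: "('k::field \<Rightarrow> 'a \<Rightarrow> 'a) \<Rightarrow> ('a::ring_1, 'k) tensor2 \<Rightarrow> ('a, 'k) tensor2 \<Rightarrow> ('a, 'k) tensor2"
  where "tensor2_mult s X Y = tensor2_class s
    (lin_extend fscale (\<lambda>(a, b). lin_extend fscale (\<lambda>(c, d). basis_elem (a * c, b * d)) (rep Y)) (rep X))"

text \<open>The linear map \<open>A \<otimes> A \<rightarrow> V\<close> with \<open>a \<otimes> b \<mapsto> \<beta> a b\<close>, for bilinear \<open>\<beta>\<close>.\<close>

definition tensor2_lift :: "('k::field \<Rightarrow> 'v \<Rightarrow> 'v) \<Rightarrow> ('a \<Rightarrow> 'a \<Rightarrow> 'v) \<Rightarrow> ('a::ab_group_add, 'k) tensor2 \<Rightarrow> 'v::ab_group_add"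
  where "tensor2_lift s \<beta> X = lin_extend s (\<lambda>(a, b). \<beta> a b) (rep X)"

definition comult_tensor_id :: "('k::field \<Rightarrow> 'a \<Rightarrow> 'a) \<Rightarrow> ('a \<Rightarrow> ('a, 'k) tensor2) \<Rightarrow> ('a::ab_group_add, 'k) tensor2 \<Rightarrow> ('a, 'k) tensor3"
  where "comult_tensor_id s \<Delta> X = tensor3_class s
    (lin_extend fscale (\<lambda>(a, b). lin_extend fscale (\<lambda>(p, q). basis_elem (p, q, b)) (rep (\<Delta> a))) (rep X))"

definition id_tensor_comult :: "('k::field \<Rightarrow> 'a \<Rightarrow> 'a) \<Rightarrow> ('a \<Rightarrow> ('a, 'k) tensor2) \<Rightarrow> ('a::ab_group_add, 'k) tensor2 \<Rightarrow> ('a, 'k) tensor3"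
  where "id_tensor_comult s \<Delta> X = tensor3_class s
    (lin_extend fscale (\<lambda>(a, b). lin_extend fscale (\<lambda>(p, q). basis_elem (a, p, q)) (rep (\<Delta> b))) (rep X))"

lemma lin_extend_superset:
  fixes s :: "'k::field \<Rightarrow> 'v::ab_group_add \<Rightarrow> 'v"
  assumes "vector_space s" "finite P" "Poly_Mapping.keys x \<subseteq> P"
  shows "lin_extend s g (x :: 'x \<Rightarrow>\<^sub>0 'k) = (\<Sum>p\<in>P. s (Poly_Mapping.lookup x p) (g p))"
proof -
  interpret vector_space s by fact
  show ?thesis
    unfolding lin_extend_def using assms(2,3)
    by (intro sum.mono_neutral_left) (auto simp: in_keys_iff)
qed

lemma lin_extend_linear:
  fixes s :: "'k::field \<Rightarrow> 'v::ab_group_add \<Rightarrow> 'v"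
  assumes "vector_space s"
  shows "Vector_Spaces.linear fscale s (lin_extend s (g :: 'x \<Rightarrow> 'v))"
proof -
  interpret V: vector_space s by fact
  show ?thesis
  proof unfold_locales
    fix x y :: "'x \<Rightarrow>\<^sub>0 'k"
    let ?P = "Poly_Mapping.keys x \<union> Poly_Mapping.keys y"
    have "Poly_Mapping.keys (x + y) \<subseteq> ?P" by (rule Poly_Mapping.keys_add)
    then show "lin_extend s g (x + y) = lin_extend s g x + lin_extend s g y"
      by (simp add: lin_extend_superset[OF assms, of ?P] lookup_add V.scale_left_distrib sum.distrib)
  next
    fix c and x :: "'x \<Rightarrow>\<^sub>0 'k"
    have "Poly_Mapping.keys (fscale c x) \<subseteq> Poly_Mapping.keys x" by (auto simp: in_keys_iff)
    then show "lin_extend s g (fscale c x) = s c (lin_extend s g x)"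
      by (simp add: lin_extend_superset[OF assms, of "Poly_Mapping.keys x"] V.scale_sum_right)
  qed
qed

lemma lin_extend_basis_elem [simp]:
  fixes s :: "'k::field \<Rightarrow> 'v::ab_group_add \<Rightarrow> 'v"
  assumes "vector_space s"
  shows "lin_extend s g (basis_elem p) = g p"
  using vector_space.vector_space_assms(4)[OF assms] by (simp add: lin_extend_def)

lemma linD_add: "Vector_Spaces.linear s s' f \<Longrightarrow> f (x + y) = f x + f y"
  and linD_scale: "Vector_Spaces.linear s s' f \<Longrightarrow> f (s t x) = s' t (f x)"
  by (auto simp: Vector_Spaces.linear_iff)

lemma tensor2_lift_class:
  assumes s: "vector_space s" and s': "vector_space s'"
    and l: "\<And>b. Vector_Spaces.linear s s' (\<lambda>a. \<beta> a b)"
    and r: "\<And>a. Vector_Spaces.linear s s' (\<lambda>b. \<beta> a b)"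
  shows "tensor2_lift s' \<beta> (tensor2_class s x) = lin_extend s' (\<lambda>(a, b). \<beta> a b) x"
proof -
  let ?L = "lin_extend s' (\<lambda>(a, b). \<beta> a b)"
  interpret L: Vector_Spaces.linear fscale s' ?L by (rule lin_extend_linear[OF s'])
  note simps = L.add L.diff L.scale lin_extend_basis_elem[OF s']
  have null: "?L n = 0" if "n \<in> tensor2_null s" for n
    using that unfolding tensor2_null_def
  proof (rule L.eq_0_on_span[rotated])
    fix n
    assume "n \<in> {basis_elem (a + b, c) - basis_elem (a, c) - basis_elem (b, c) | a b c. True} \<union>
     {basis_elem (a, b + c) - basis_elem (a, b) - basis_elem (a, c) | a b c. True} \<union>
     {basis_elem (s t a, b) - fscale t (basis_elem (a, b)) | t a b. True} \<union>
     {basis_elem (a, s t b) - fscale t (basis_elem (a, b)) | t a b. True}"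
    then show "?L n = 0"
      by (auto simp: simps linD_add[OF l] linD_add[OF r]
          linD_scale[OF l] linD_scale[OF r])
  qed
  have "x \<in> tensor2_class s x"
    using free_space.span_zero
    by (auto simp: tensor2_class_def elt_set_plus_def tensor2_null_def)
  then have "rep (tensor2_class s x) \<in> tensor2_class s x"
    unfolding rep_def by (rule someI)
  then obtain n where "n \<in> tensor2_null s" "rep (tensor2_class s x) = x + n"
    by (auto simp: tensor2_class_def elt_set_plus_def)
  then show ?thesis
    by (simp add: tensor2_lift_def L.add null)
qed

locale algebra_over = vector_space scale
  for scale :: "'k::field \<Rightarrow> 'a::ring_1 \<Rightarrow> 'a" +
  assumes scale_mult_left: "scale t a * b = scale t (a * b)"
    and scale_mult_right: "a * scale t b = scale t (a * b)"

locale bialgebra = algebra_over scale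
  for scale :: "'k::field \<Rightarrow> 'a::ring_1 \<Rightarrow> 'a" +
  fixes \<Delta> :: "'a \<Rightarrow> ('a, 'k) tensor2"
    and \<epsilon> :: "'a \<Rightarrow> 'k"
  assumes comult_in: "\<Delta> a \<in> tensor2_space scale"
    and comult_add: "\<Delta> (a + b) = tensor2_add scale (\<Delta> a) (\<Delta> b)"
    and comult_scale: "\<Delta> (scale t a) = tensor2_smult scale t (\<Delta> a)"
    and counit_linear: "Vector_Spaces.linear scale (*) \<epsilon>"
    and coassoc: "comult_tensor_id scale \<Delta> (\<Delta> a) = id_tensor_comult scale \<Delta> (\<Delta> a)"
    and counit_left: "tensor2_lift scale (\<lambda>x y. scale (\<epsilon> x) y) (\<Delta> a) = a"
    and counit_right: "tensor2_lift scale (\<lambda>x y. scale (\<epsilon> y) x) (\<Delta> a) = a"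
    and comult_mult: "\<Delta> (a * b) = tensor2_mult scale (\<Delta> a) (\<Delta> b)"
    and comult_one: "\<Delta> 1 = tensor2_class scale (basis_elem (1, 1))"
    and counit_mult: "\<epsilon> (a * b) = \<epsilon> a * \<epsilon> b"
    and counit_one: "\<epsilon> 1 = 1"

locale hopf_algebra = bialgebra scale \<Delta> \<epsilon>
  for scale :: "'k::field \<Rightarrow> 'a::ring_1 \<Rightarrow> 'a" and \<Delta> and \<epsilon> +
  fixes S :: "'a \<Rightarrow> 'a"
  assumes antipode_linear: "Vector_Spaces.linear scale scale S"
    and antipode_left: "tensor2_lift scale (\<lambda>x y. S x * y) (\<Delta> a) = scale (\<epsilon> a) 1"
    and antipode_right: "tensor2_lift scale (\<lambda>x y. x * S y) (\<Delta> a) = scale (\<epsilon> a) 1"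

text \<open>\<open>f \<triangleright> a = (id \<otimes> f)(\<Delta>(a))\<close>, with \<open>A \<otimes> \<kk>\<close> identified with \<open>A\<close>.\<close>

definition left_act :: "('k::field \<Rightarrow> 'a \<Rightarrow> 'a) \<Rightarrow> ('a \<Rightarrow> ('a, 'k) tensor2) \<Rightarrow> ('a \<Rightarrow> 'k) \<Rightarrow> 'a \<Rightarrow> 'a::ring_1"
  where "left_act s \<Delta> f a = tensor2_lift s (\<lambda>x y. s (f y) x) (\<Delta> a)"

definition right_integral :: "('k::field \<Rightarrow> 'a \<Rightarrow> 'a) \<Rightarrow> ('a \<Rightarrow> ('a, 'k) tensor2) \<Rightarrow> ('a::ring_1 \<Rightarrow> 'k) \<Rightarrow> bool"
  where "right_integral s \<Delta> l \<longleftrightarrow>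
    Vector_Spaces.linear s (*) l \<and>
    (\<forall>a. tensor2_lift s (\<lambda>x y. s (l x) y) (\<Delta> a) = s (l a) 1)"

text \<open>The index set \<open>{1, \<dots>, n}\<close> is a finite type \<open>'n\<close>.\<close>

definition matrix_algebra_map :: "('k::field \<Rightarrow> 'a \<Rightarrow> 'a) \<Rightarrow> ('n::finite \<Rightarrow> 'n \<Rightarrow> 'a \<Rightarrow> 'a::ring_1) \<Rightarrow> bool"
  where "matrix_algebra_map s \<sigma> \<longleftrightarrow>
    (\<forall>i j. Vector_Spaces.linear s s (\<sigma> i j)) \<and>
    (\<forall>i j a b. \<sigma> i j (a * b) = (\<Sum>k\<in>UNIV. \<sigma> i k a * \<sigma> k j b)) \<and>
    (\<forall>i j. \<sigma> i j 1 = (if i = j then 1 else 0))"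

definition free_right_twisted_multi_derivation ::
  "('k::field \<Rightarrow> 'a \<Rightarrow> 'a) \<Rightarrow> ('n::finite \<Rightarrow> 'a \<Rightarrow> 'a) \<Rightarrow> ('n \<Rightarrow> 'n \<Rightarrow> 'a \<Rightarrow> 'a) \<Rightarrow>
   ('n \<Rightarrow> 'n \<Rightarrow> 'a \<Rightarrow> 'a) \<Rightarrow> ('n \<Rightarrow> 'n \<Rightarrow> 'a \<Rightarrow> 'a::ring_1) \<Rightarrow> bool"
  where "free_right_twisted_multi_derivation s d \<sigma> \<sigma>bar \<sigma>hat \<longleftrightarrow>
    (\<forall>i. Vector_Spaces.linear s s (d i)) \<and>
    matrix_algebra_map s \<sigma> \<and>
    matrix_algebra_map s \<sigma>bar \<and>
    (\<forall>i j. Vector_Spaces.linear s s (\<sigma>hat i j)) \<and>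
    (\<forall>i a b. d i (a * b) = (\<Sum>j\<in>UNIV. d j a * \<sigma> j i b) + a * d i b) \<and>
    (\<forall>i j a. (\<Sum>k\<in>UNIV. \<sigma>bar i k (\<sigma> j k a)) = (if i = j then a else 0)) \<and>
    (\<forall>i j a. (\<Sum>k\<in>UNIV. \<sigma> k i (\<sigma>bar k j a)) = (if i = j then a else 0)) \<and>
    (\<forall>i j a. (\<Sum>k\<in>UNIV. \<sigma>hat i k (\<sigma>bar j k a)) = (if i = j then a else 0)) \<and>
    (\<forall>i j a. (\<Sum>k\<in>UNIV. \<sigma>bar k i (\<sigma>hat k j a)) = (if i = j then a else 0))"

text \<open>
  \<open>\<Omega>\<^sup>1(A)\<close> is \<open>'a ^ 'n\<close>: the vector \<open>u\<close> stands for \<open>\<Sum>\<^sub>i u\<^sub>i \<omega>\<^sub>i\<close>, so \<open>\<omega>\<^sub>i = axis i 1\<close> and the left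
  action is \<open>(*s)\<close>.  The right action is
  \<open>(\<Sum>\<^sub>i u\<^sub>i \<omega>\<^sub>i) a = \<Sum>\<^sub>i u\<^sub>i (\<omega>\<^sub>i a) = \<Sum>\<^sub>j (\<Sum>\<^sub>i u\<^sub>i \<sigma>\<^sub>i\<^sub>j(a)) \<omega>\<^sub>j\<close>.
\<close>

definition form_right_act :: "('n::finite \<Rightarrow> 'n \<Rightarrow> 'a \<Rightarrow> 'a) \<Rightarrow> 'a ^ 'n \<Rightarrow> 'a \<Rightarrow> 'a::ring_1 ^ 'n"
  where "form_right_act \<sigma> u a = (\<chi> j. \<Sum>i\<in>UNIV. u $ i * \<sigma> i j a)"

definition form_hom :: "('n::finite \<Rightarrow> 'n \<Rightarrow> 'a \<Rightarrow> 'a) \<Rightarrow> ('a::ring_1 ^ 'n \<Rightarrow> 'a) set"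
  where "form_hom \<sigma> = {f. (\<forall>u v. f (u + v) = f u + f v) \<and> (\<forall>u a. f (form_right_act \<sigma> u a) = f u * a)}"

definition twisted_partial :: "('n::finite \<Rightarrow> 'a \<Rightarrow> 'a) \<Rightarrow> ('n \<Rightarrow> 'n \<Rightarrow> 'a \<Rightarrow> 'a) \<Rightarrow> ('n \<Rightarrow> 'n \<Rightarrow> 'a \<Rightarrow> 'a) \<Rightarrow> 'n \<Rightarrow> 'a \<Rightarrow> 'a::ring_1"
  where "twisted_partial d \<sigma>bar \<sigma>hat i a = (\<Sum>j\<in>UNIV. \<Sum>k\<in>UNIV. \<sigma>bar k j (d j (\<sigma>hat k i a)))"

definition divergence :: "('n::finite \<Rightarrow> 'a \<Rightarrow> 'a) \<Rightarrow> ('n \<Rightarrow> 'n \<Rightarrow> 'a \<Rightarrow> 'a) \<Rightarrow> ('n \<Rightarrow> 'n \<Rightarrow> 'a \<Rightarrow> 'a) \<Rightarrow> ('a ^ 'n \<Rightarrow> 'a) \<Rightarrow> 'a::ring_1"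
  where "divergence d \<sigma>bar \<sigma>hat f = (\<Sum>i\<in>UNIV. twisted_partial d \<sigma>bar \<sigma>hat i (f (axis i 1)))"

definition divergence_image :: "('n::finite \<Rightarrow> 'a \<Rightarrow> 'a) \<Rightarrow> ('n \<Rightarrow> 'n \<Rightarrow> 'a \<Rightarrow> 'a) \<Rightarrow> ('n \<Rightarrow> 'n \<Rightarrow> 'a \<Rightarrow> 'a) \<Rightarrow> ('n \<Rightarrow> 'n \<Rightarrow> 'a \<Rightarrow> 'a) \<Rightarrow> 'a::ring_1 set"
  where "divergence_image d \<sigma> \<sigma>bar \<sigma>hat = divergence d \<sigma>bar \<sigma>hat ` form_hom \<sigma>"

text \<open>
  With \<open>\<nabla>\<close> the map \<open>divergence\<close>, the elements of \<open>A / im \<nabla>\<close> are the cosets \<open>a +o im \<nabla>\<close>; its zero is the coset of \<open>0\<close>.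
\<close>

definition relative_integral :: "('n::finite \<Rightarrow> 'a \<Rightarrow> 'a) \<Rightarrow> ('n \<Rightarrow> 'n \<Rightarrow> 'a \<Rightarrow> 'a) \<Rightarrow> ('n \<Rightarrow> 'n \<Rightarrow> 'a \<Rightarrow> 'a) \<Rightarrow> ('n \<Rightarrow> 'n \<Rightarrow> 'a \<Rightarrow> 'a) \<Rightarrow> 'a \<Rightarrow> 'a::ring_1 set"
  where "relative_integral d \<sigma> \<sigma>bar \<sigma>hat a = a +o divergence_image d \<sigma> \<sigma>bar \<sigma>hat"

definition coker_zero :: "('n::finite \<Rightarrow> 'a \<Rightarrow> 'a) \<Rightarrow> ('n \<Rightarrow> 'n \<Rightarrow> 'a \<Rightarrow> 'a) \<Rightarrow> ('n \<Rightarrow> 'n \<Rightarrow> 'a \<Rightarrow> 'a) \<Rightarrow> ('n \<Rightarrow> 'n \<Rightarrow> 'a \<Rightarrow> 'a) \<Rightarrow> 'a::ring_1 set"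
  where "coker_zero d \<sigma> \<sigma>bar \<sigma>hat = 0 +o divergence_image d \<sigma> \<sigma>bar \<sigma>hat"

end

theory Submission
  imports Defs
begin

text \<open>
  All maps in the claim act through functionals: writing \<open>a\<^sub>1 \<otimes> a\<^sub>2\<close> for \<open>\<Delta>(a)\<close>, \<open>f \<triangleright> a = a\<^sub>1 f(a\<^sub>2)\<close> satisfies
  \<open>f \<triangleright> (g \<triangleright> a) = (f * g) \<triangleright> a\<close>, where \<open>f * g\<close> is the convolution product (\<open>act_act\<close>).  So identities
  between these operators follow from identities between functionals.  The four inverse relations for
  \<open>\<sigma>\<close>, \<open>\<sigma>bar\<close>, \<open>\<sigma>hat\<close> then come from multiplicativity of the matrix \<open>\<theta>\<close> together with
  \<open>a\<^sub>2 S\<inverse>(a\<^sub>1) = \<epsilon>(a) 1 = S\<inverse>(a\<^sub>2) a\<^sub>1\<close>.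

  The heart of the proof is that the twisted partial derivative is again an action,
  \<open>\<partial>\<^sub>i\<^sup>\<sigma> = (\<chi>\<^sub>i \<circ> S\<inverse> \<circ> S\<inverse>) \<triangleright>\<close> (\<open>twisted_partial_eq\<close>).  Since \<open>\<chi>\<^sub>i(1) = 0\<close>, applying \<open>\<chi>\<^sub>i\<close> to
  \<open>x\<^sub>2 S\<inverse>(x\<^sub>1) = \<epsilon>(x) 1\<close> expresses \<open>\<chi>\<^sub>i \<circ> S\<inverse>\<close> as \<open>- \<Sum>\<^sub>j (\<theta>\<^sub>j\<^sub>i \<circ> S\<inverse>) * \<chi>\<^sub>j\<close>, which removes the leftmost
  factor of \<open>\<partial>\<^sub>i\<^sup>\<sigma>\<close>, and applying it to \<open>S\<inverse>(S\<inverse>(x\<^sub>2) x\<^sub>1) = \<epsilon>(x) 1\<close> removes the rightmost one.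

  The form module is also free as a right module on the \<open>\<omega>\<^sub>i\<close>, so for each \<open>a\<close> and \<open>i\<close> there is a right
  linear map with \<open>\<omega>\<^sub>j \<mapsto> \<delta>\<^sub>i\<^sub>j a\<close>; its divergence is \<open>\<partial>\<^sub>i\<^sup>\<sigma>(a)\<close>.  Hence \<open>(\<chi>\<^sub>i \<circ> S\<inverse> \<circ> S\<inverse>) \<triangleright> a\<close> lies in the
  image of the divergence.  As \<open>S\<close> reverses coproducts, \<open>S \<circ> S\<close> preserves them and
  \<open>S(S(\<partial>\<^sub>i(a))) = (\<chi>\<^sub>i \<circ> S\<inverse> \<circ> S\<inverse>) \<triangleright> S(S(a))\<close> lies there as well.  Finally a right integral satisfies
  \<open>\<lambda>(f \<triangleright> a) = \<lambda>(a) f(1)\<close>, and \<open>\<chi>\<^sub>i(S\<inverse>(S\<inverse>(1))) = \<chi>\<^sub>i(1) = 0\<close>.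

  The tensor square enters only through the bilinear maps evaluated on it.  An expression such as
  \<open>\<beta>(a\<^sub>1, a\<^sub>2)\<close> is written \<open>sweedler s' \<beta> a\<close>, and coassociativity, multiplicativity of \<open>\<Delta>\<close> and the antipode
  axioms become rewrite rules for nested \<open>sweedler\<close> expressions (\<open>sweedler_coassoc\<close>, \<open>sweedler_mult\<close>,
  \<open>sweedler_antipode_left\<close>), whose side conditions are linearity in each variable.
\<close>

section \<open>Linear maps between scalar multiplications\<close>

text \<open>
  Introduction rules that establish linearity by recursion on the body of an abstraction.  They
  discharge the side conditions of the Sweedler rules.
\<close>

named_theorems lin_intros

lemma linear_vector_spaces:
  assumes "Vector_Spaces.linear s s' f"
  shows "vector_space s" "vector_space s'"
  using assms by (auto simp: Vector_Spaces.linear_iff)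

lemma vector_space_field [lin_intros]: "vector_space ((*) :: 'k::field \<Rightarrow> 'k \<Rightarrow> 'k)"
  by unfold_locales (auto simp: algebra_simps)

lemma linear_ident [lin_intros]:
  "vector_space s \<Longrightarrow> Vector_Spaces.linear s s (\<lambda>x. x)"
  by (simp add: Vector_Spaces.linear_iff)

text \<open>
  This rule would apply to every goal, so only its instances for particular outer functions
  are introduction rules.
\<close>

lemma linear_compose_lambda:
  "Vector_Spaces.linear s' s'' f \<Longrightarrow> Vector_Spaces.linear s s' g \<Longrightarrow> Vector_Spaces.linear s s'' (\<lambda>x. f (g x))"
  by (simp add: Vector_Spaces.linear_iff)

lemma linear_scale_vector [lin_intros]:
  "Vector_Spaces.linear s s' g \<Longrightarrow> Vector_Spaces.linear s s' (\<lambda>x. s' c (g x))"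
  by (auto simp: Vector_Spaces.linear_iff vector_space_def mult.commute)

lemma linear_scale_coefficient [lin_intros]:
  "vector_space s' \<Longrightarrow> Vector_Spaces.linear s (*) g \<Longrightarrow> Vector_Spaces.linear s s' (\<lambda>x. s' (g x) v)"
  by (auto simp: Vector_Spaces.linear_iff vector_space_def)

lemma linear_mult_right [lin_intros]:
  "algebra_over s' \<Longrightarrow> Vector_Spaces.linear s s' g \<Longrightarrow> Vector_Spaces.linear s s' (\<lambda>x. g x * c)"
  by (auto simp: Vector_Spaces.linear_iff algebra_over_def algebra_over_axioms_def algebra_simps)

lemma linear_mult_left [lin_intros]:
  "algebra_over s' \<Longrightarrow> Vector_Spaces.linear s s' g \<Longrightarrow> Vector_Spaces.linear s s' (\<lambda>x. c * g x)"
  by (auto simp: Vector_Spaces.linear_iff algebra_over_def algebra_over_axioms_def algebra_simps)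

lemma linear_sum:
  assumes "vector_space s" "vector_space s'" "\<And>i. Vector_Spaces.linear s s' (f i)"
  shows "Vector_Spaces.linear s s' (\<lambda>x. \<Sum>i\<in>I. f i x)"
proof -
  interpret vector_space s' by fact
  show ?thesis
    using assms by (auto simp: Vector_Spaces.linear_iff sum.distrib scale_sum_right)
qed

section \<open>Maps out of the tensor square\<close>

lemma linear_map_sum:
  assumes "Vector_Spaces.linear s s' f"
  shows "f (\<Sum>i\<in>I. g i) = (\<Sum>i\<in>I. f (g i))"
proof -
  interpret Vector_Spaces.linear s s' f by fact
  show ?thesis by (rule sum)
qed

lemma linear_lin_extend:
  assumes f: "Vector_Spaces.linear s s' f"
  shows "f (lin_extend s g x) = lin_extend s' (\<lambda>p. f (g p)) x"
  unfolding lin_extend_def by (simp add: linear_map_sum[OF f] linD_scale[OF f])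

lemma linear_tensor2_lift:
  assumes "Vector_Spaces.linear s s' f"
  shows "f (tensor2_lift s \<beta> X) = tensor2_lift s' (\<lambda>x y. f (\<beta> x y)) X"
  unfolding tensor2_lift_def by (simp add: linear_lin_extend[OF assms] case_prod_unfold)

lemma linear_tensor2_lift_parameter:
  assumes "vector_space s" "vector_space s'"
    and "\<And>x y. Vector_Spaces.linear s s' (\<lambda>u. \<beta> u x y)"
  shows "Vector_Spaces.linear s s' (\<lambda>u. tensor2_lift s' (\<lambda>x y. \<beta> u x y) X)"
  unfolding tensor2_lift_def lin_extend_def case_prod_unfold
  by (intro linear_sum linear_scale_vector assms)

text \<open>
  The analogue of Fubini's theorem for Sweedler sums: values on the chosen representatives are
  finite sums, so splittings of two independent elements can be done in either order.
\<close>

lemma tensor2_lift_commute: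
  assumes "vector_space s"
  shows "tensor2_lift s (\<lambda>x y. tensor2_lift s (\<lambda>u v. \<gamma> x y u v) Y) X
       = tensor2_lift s (\<lambda>u v. tensor2_lift s (\<lambda>x y. \<gamma> x y u v) X) Y"
proof -
  interpret vector_space s by fact
  show ?thesis
    unfolding tensor2_lift_def lin_extend_def case_prod_unfold
    by (simp add: scale_sum_right mult.commute) (rule sum.swap)
qed

lemma tensor2_lift_sum:
  assumes "vector_space s"
  shows "tensor2_lift s (\<lambda>x y. \<Sum>i\<in>I. \<beta> i x y) X = (\<Sum>i\<in>I. tensor2_lift s (\<beta> i) X)"
proof -
  interpret vector_space s by fact
  show ?thesis
    unfolding tensor2_lift_def lin_extend_def case_prod_unfold
    by (simp add: scale_sum_right) (rule sum.swap)
qed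

lemma tensor2_lift_add:
  assumes "vector_space s"
  shows "tensor2_lift s (\<lambda>x y. \<beta> x y + \<gamma> x y) X = tensor2_lift s \<beta> X + tensor2_lift s \<gamma> X"
proof -
  interpret vector_space s by fact
  show ?thesis
    unfolding tensor2_lift_def lin_extend_def case_prod_unfold
    by (simp add: scale_right_distrib sum.distrib)
qed

definition bilinear_map where
  "bilinear_map s s' \<beta> \<longleftrightarrow>
    (\<forall>b. Vector_Spaces.linear s s' (\<lambda>a. \<beta> a b)) \<and> (\<forall>a. Vector_Spaces.linear s s' (\<lambda>b. \<beta> a b))"

lemma bilinear_mapI [lin_intros]:
  assumes "\<And>b. Vector_Spaces.linear s s' (\<lambda>a. \<beta> a b)" "\<And>a. Vector_Spaces.linear s s' (\<lambda>b. \<beta> a b)"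
  shows "bilinear_map s s' (\<lambda>a b. \<beta> a b)"
  using assms by (simp add: bilinear_map_def)

lemma bilinear_map_linear:
  assumes "bilinear_map s s' \<beta>"
  shows "Vector_Spaces.linear s s' (\<lambda>a. \<beta> a b)" "Vector_Spaces.linear s s' (\<lambda>b. \<beta> a b)"
  using assms by (simp_all add: bilinear_map_def)

lemma bilinear_map_vector_spaces:
  assumes "bilinear_map s s' \<beta>"
  shows "vector_space s" "vector_space s'"
  using linear_vector_spaces[OF bilinear_map_linear(1)[OF assms]] .

lemma bilinear_map_comp:
  assumes "bilinear_map s s' \<beta>" "Vector_Spaces.linear t s g"
  shows "Vector_Spaces.linear t s' (\<lambda>a. \<beta> (g a) b)" "Vector_Spaces.linear t s' (\<lambda>b. \<beta> a (g b))"
  using assms by (auto simp: bilinear_map_def Vector_Spaces.linear_iff)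

lemma tensor2_lift_of_class:
  assumes "bilinear_map s s' \<beta>"
  shows "tensor2_lift s' \<beta> (tensor2_class s x) = lin_extend s' (\<lambda>(a, b). \<beta> a b) x"
  using bilinear_map_vector_spaces[OF assms] bilinear_map_linear[OF assms]
  by (intro tensor2_lift_class)

text \<open>
  A trilinear map kills the multilinearity relations, so it factors through the triple tensor
  product.  This turns coassociativity, an equation of cosets, into equations of values.
\<close>

lemma trilinear_lin_extend_cong:
  fixes s :: "'k::field \<Rightarrow> 'a::ab_group_add \<Rightarrow> 'a" and s' :: "'k \<Rightarrow> 'v::ab_group_add \<Rightarrow> 'v"
  assumes s': "vector_space s'"
    and l1: "\<And>b c. Vector_Spaces.linear s s' (\<lambda>a. \<gamma> a b c)"
    and l2: "\<And>a c. Vector_Spaces.linear s s' (\<lambda>b. \<gamma> a b c)"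
    and l3: "\<And>a b. Vector_Spaces.linear s s' (\<lambda>c. \<gamma> a b c)"
    and eq: "tensor3_class s x = tensor3_class s y"
  shows "lin_extend s' (\<lambda>(a, b, c). \<gamma> a b c) x = lin_extend s' (\<lambda>(a, b, c). \<gamma> a b c) y"
proof -
  let ?L = "lin_extend s' (\<lambda>(a, b, c). \<gamma> a b c)"
  interpret L: Vector_Spaces.linear fscale s' ?L by (rule lin_extend_linear[OF s'])
  note simps = L.add L.diff L.scale lin_extend_basis_elem[OF s']
  have null: "?L n = 0" if "n \<in> tensor3_null s" for n
    using that unfolding tensor3_null_def
    by (rule L.eq_0_on_span[rotated])
      (auto simp: simps linD_add[OF l1] linD_add[OF l2] linD_add[OF l3]
        linD_scale[OF l1] linD_scale[OF l2] linD_scale[OF l3])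
  have "x \<in> tensor3_class s x"
    using free_space.span_zero by (auto simp: tensor3_class_def elt_set_plus_def tensor3_null_def)
  then obtain n where "n \<in> tensor3_null s" "x = y + n"
    unfolding eq by (auto simp: tensor3_class_def elt_set_plus_def)
  then show ?thesis by (simp add: L.add null)
qed

section \<open>Sweedler calculus\<close>

context bialgebra
begin

abbreviation sweedler ::
    "('k \<Rightarrow> 'v \<Rightarrow> 'v) \<Rightarrow> ('a \<Rightarrow> 'a \<Rightarrow> 'v) \<Rightarrow> 'a \<Rightarrow> 'v::ab_group_add"
  where "sweedler s' \<beta> a \<equiv> tensor2_lift s' \<beta> (\<Delta> a)"

lemmas [lin_intros] = algebra_over_axioms vector_space_axioms

lemma counit_compose [lin_intros]:
  "Vector_Spaces.linear s scale g \<Longrightarrow> Vector_Spaces.linear s (*) (\<lambda>x. \<epsilon> (g x))"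
  by (rule linear_compose_lambda[OF counit_linear])

lemma sweedler_linear:
  assumes \<beta>: "bilinear_map scale s' \<beta>"
  shows "Vector_Spaces.linear scale s' (sweedler s' \<beta>)"
proof -
  note s' = bilinear_map_vector_spaces(2)[OF \<beta>]
  interpret L: Vector_Spaces.linear fscale s' "lin_extend s' (\<lambda>(a, b). \<beta> a b)"
    by (rule lin_extend_linear[OF s'])
  show ?thesis
    by (simp add: Vector_Spaces.linear_iff vector_space_axioms s' comult_add comult_scale
        tensor2_add_def tensor2_smult_def tensor2_lift_of_class[OF \<beta>] L.add L.scale)
      (simp add: tensor2_lift_def)
qed

lemma sweedler_linear_compose [lin_intros]:
  assumes "bilinear_map scale s' (\<lambda>x y. \<beta> x y)" "Vector_Spaces.linear s scale g"
  shows "Vector_Spaces.linear s s' (\<lambda>x. sweedler s' (\<lambda>x y. \<beta> x y) (g x))"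
  by (rule linear_compose_lambda[OF sweedler_linear[OF assms(1)] assms(2)])

lemmas [lin_intros] = linear_tensor2_lift_parameter

lemma sweedler_coassoc:
  assumes s': "vector_space s'"
    and l1: "\<And>b c. Vector_Spaces.linear scale s' (\<lambda>a. \<gamma> a b c)"
    and l2: "\<And>a c. Vector_Spaces.linear scale s' (\<lambda>b. \<gamma> a b c)"
    and l3: "\<And>a b. Vector_Spaces.linear scale s' (\<lambda>c. \<gamma> a b c)"
  shows "sweedler s' (\<lambda>x y. sweedler s' (\<lambda>p q. \<gamma> p q y) x) a
       = sweedler s' (\<lambda>x y. sweedler s' (\<lambda>p q. \<gamma> x p q) y) a"
proof -
  let ?L = "lin_extend s' (\<lambda>(a, b, c). \<gamma> a b c)"
  note L = linear_lin_extend[OF lin_extend_linear[OF s'], of "\<lambda>(a, b, c). \<gamma> a b c", unfolded case_prod_unfold]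
  have "?L (lin_extend fscale (\<lambda>(a, b). lin_extend fscale (\<lambda>(p, q). basis_elem (p, q, b)) (rep (\<Delta> a))) (rep (\<Delta> a)))
      = ?L (lin_extend fscale (\<lambda>(a, b). lin_extend fscale (\<lambda>(p, q). basis_elem (a, p, q)) (rep (\<Delta> b))) (rep (\<Delta> a)))"
    using coassoc[of a] unfolding comult_tensor_id_def id_tensor_comult_def
    by (rule trilinear_lin_extend_cong[OF s' l1 l2 l3])
  then show ?thesis
    by (simp add: L case_prod_unfold tensor2_lift_def lin_extend_basis_elem[OF s'])
qed

lemma sweedler_mult:
  assumes \<beta>: "bilinear_map scale s' \<beta>"
  shows "sweedler s' \<beta> (a * b) = sweedler s' (\<lambda>x y. sweedler s' (\<lambda>z w. \<beta> (x * z) (y * w)) b) a"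
proof -
  note s' = bilinear_map_vector_spaces(2)[OF \<beta>]
  note L = linear_lin_extend[OF lin_extend_linear[OF s'], of "\<lambda>(a, b). \<beta> a b", unfolded case_prod_unfold]
  show ?thesis
    unfolding comult_mult tensor2_mult_def tensor2_lift_of_class[OF \<beta>]
    by (simp add: L case_prod_unfold lin_extend_basis_elem[OF s'] tensor2_lift_def)
qed

lemma sweedler_one:
  assumes \<beta>: "bilinear_map scale s' \<beta>"
  shows "sweedler s' \<beta> 1 = \<beta> 1 1"
  unfolding comult_one tensor2_lift_of_class[OF \<beta>]
  by (simp add: lin_extend_basis_elem[OF bilinear_map_vector_spaces(2)[OF \<beta>]])

lemma sweedler_counit_left:
  assumes f: "Vector_Spaces.linear scale s' f"
  shows "sweedler s' (\<lambda>x y. s' (\<epsilon> x) (f y)) a = f a"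
  using linear_tensor2_lift[OF f, of "\<lambda>x y. scale (\<epsilon> x) y" "\<Delta> a"]
  by (simp add: counit_left linD_scale[OF f])

lemma sweedler_counit_right:
  assumes f: "Vector_Spaces.linear scale s' f"
  shows "sweedler s' (\<lambda>x y. s' (\<epsilon> y) (f x)) a = f a"
  using linear_tensor2_lift[OF f, of "\<lambda>x y. scale (\<epsilon> y) x" "\<Delta> a"]
  by (simp add: counit_right linD_scale[OF f])

end

section \<open>The antipode reverses products and coproducts\<close>

context hopf_algebra
begin

lemma antipode_compose [lin_intros]:
  "Vector_Spaces.linear s scale g \<Longrightarrow> Vector_Spaces.linear s scale (\<lambda>x. S (g x))"
  by (rule linear_compose_lambda[OF antipode_linear])

lemma sweedler_antipode_left:
  assumes f: "Vector_Spaces.linear scale s' f"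
  shows "sweedler s' (\<lambda>x y. f (S x * y)) a = s' (\<epsilon> a) (f 1)"
  using linear_tensor2_lift[OF f, of "\<lambda>x y. S x * y" "\<Delta> a"]
  by (simp add: antipode_left linD_scale[OF f])

lemma sweedler_antipode_right:
  assumes f: "Vector_Spaces.linear scale s' f"
  shows "sweedler s' (\<lambda>x y. f (x * S y)) a = s' (\<epsilon> a) (f 1)"
  using linear_tensor2_lift[OF f, of "\<lambda>x y. x * S y" "\<Delta> a"]
  by (simp add: antipode_right linD_scale[OF f])

lemma antipode_one: "S 1 = 1"
proof -
  have "bilinear_map scale scale (\<lambda>x y. S x * y)" by (intro lin_intros)
  then show ?thesis
    using sweedler_one[of scale "\<lambda>x y. S x * y"] antipode_left[of 1] by (simp add: counit_one)
qed

text \<open>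
  Both sides are values of
  \<open>S(a\<^sub>1 b\<^sub>1) a\<^sub>2 b\<^sub>2 S(b\<^sub>3) S(a\<^sub>3)\<close>: contracting the factors with indices 2 and 3 first leaves \<open>S(a b)\<close>,
  contracting those with indices 1 and 2 first leaves \<open>S(b) S(a)\<close>.
\<close>

lemma antipode_mult: "S (a * b) = S b * S a"
proof -
  let ?G = "\<lambda>x p q z m n. S (x * z) * (p * m) * (S n * S q)"
  have inner: "sweedler scale (\<lambda>p q. sweedler scale (\<lambda>m n. ?G x p q z m n) w) y
      = scale (\<epsilon> w) (scale (\<epsilon> y) (S (x * z)))" for x y z w
  proof -
    have "sweedler scale (\<lambda>m n. ?G x p q z m n) w = scale (\<epsilon> w) (S (x * z) * p * S q)" for p q
    proof -
      have "sweedler scale (\<lambda>m n. S (x * z) * p * (m * S n) * S q) w = scale (\<epsilon> w) (S (x * z) * p * 1 * S q)"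
        by (rule sweedler_antipode_right) (intro lin_intros)
      then show ?thesis by (simp add: mult.assoc)
    qed
    moreover have "sweedler scale (\<lambda>p q. scale (\<epsilon> w) (S (x * z) * (p * S q))) y
        = scale (\<epsilon> y) (scale (\<epsilon> w) (S (x * z) * 1))"
      by (rule sweedler_antipode_right) (intro lin_intros)
    ultimately show ?thesis by (simp add: mult.assoc mult.commute)
  qed
  have outer: "sweedler scale (\<lambda>x p. sweedler scale (\<lambda>z m. ?G x p q z m n) z') x'
      = scale (\<epsilon> z') (scale (\<epsilon> x') (S n * S q))" for x' z' n q
  proof -
    have "sweedler scale (\<lambda>x p. sweedler scale (\<lambda>z m. ?G x p q z m n) z') x'
        = sweedler scale (\<lambda>u v. S u * v * (S n * S q)) (x' * z')"
      by (rule sweedler_mult[symmetric]) (intro lin_intros)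
    also have "\<dots> = scale (\<epsilon> (x' * z')) (1 * (S n * S q))"
      by (rule sweedler_antipode_left) (intro lin_intros)
    finally show ?thesis by (simp add: counit_mult mult.commute)
  qed
  have "S (a * b) = sweedler scale (\<lambda>x y. scale (\<epsilon> y) (S (x * b))) a"
    by (rule sweedler_counit_right[symmetric]) (intro lin_intros)
  also have "\<dots> = sweedler scale (\<lambda>x y. sweedler scale (\<lambda>z w. scale (\<epsilon> w) (scale (\<epsilon> y) (S (x * z)))) b) a"
    by (subst sweedler_counit_right) (intro lin_intros refl)+
  also have "\<dots> = sweedler scale (\<lambda>x y. sweedler scale (\<lambda>z w.
      sweedler scale (\<lambda>p q. sweedler scale (\<lambda>m n. ?G x p q z m n) w) y) b) a"
    by (simp only: inner)
  also have "\<dots> = sweedler scale (\<lambda>x y. sweedler scale (\<lambda>p q.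
      sweedler scale (\<lambda>z w. sweedler scale (\<lambda>m n. ?G x p q z m n) w) b) y) a"
    by (subst tensor2_lift_commute) (intro lin_intros refl)+
  also have "\<dots> = sweedler scale (\<lambda>x y. sweedler scale (\<lambda>p q.
      sweedler scale (\<lambda>z w. sweedler scale (\<lambda>m n. ?G p q y m n w) z) b) x) a"
    by (subst (1 2) sweedler_coassoc) (intro lin_intros refl)+
  also have "\<dots> = sweedler scale (\<lambda>x y. sweedler scale (\<lambda>z w.
      sweedler scale (\<lambda>p q. sweedler scale (\<lambda>m n. ?G p q y m n w) z) x) b) a"
    by (subst tensor2_lift_commute) (intro lin_intros refl)+
  also have "\<dots> = sweedler scale (\<lambda>x y. sweedler scale (\<lambda>z w. scale (\<epsilon> z) (scale (\<epsilon> x) (S w * S y))) b) a"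
    by (simp only: outer)
  also have "\<dots> = sweedler scale (\<lambda>x y. scale (\<epsilon> x) (S b * S y)) a"
    by (subst sweedler_counit_left) (intro lin_intros refl)+
  also have "\<dots> = S b * S a"
    by (rule sweedler_counit_left) (intro lin_intros)
  finally show ?thesis .
qed

text \<open>
  This is \<open>\<Delta>(S(a)) = S(a\<^sub>2) \<otimes> S(a\<^sub>1)\<close>, tested on bilinear maps.  Evaluate
  \<open>\<beta>(S(a\<^sub>1)\<^sub>1 a\<^sub>2 S(a\<^sub>5), S(a\<^sub>1)\<^sub>2 a\<^sub>3 S(a\<^sub>4))\<close> in two ways.  Contracting \<open>a\<^sub>3 S(a\<^sub>4)\<close> and then the remaining
  \<open>a\<^sub>2 S(a\<^sub>5)\<close> leaves \<open>\<beta>(S(a)\<^sub>1, S(a)\<^sub>2)\<close>.  On the other hand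
  \<open>S(a\<^sub>1)\<^sub>1 a\<^sub>2 \<otimes> S(a\<^sub>1)\<^sub>2 a\<^sub>3 = \<Delta>(S(a\<^sub>1) a\<^sub>2)\<close>, which collapses to \<open>1 \<otimes> 1\<close> and leaves \<open>\<beta>(S(a\<^sub>2), S(a\<^sub>1))\<close>.
\<close>

lemma sweedler_antipode:
  assumes \<beta>: "bilinear_map scale s' \<beta>"
  shows "sweedler s' \<beta> (S a) = sweedler s' (\<lambda>x y. \<beta> (S y) (S x)) a"
proof -
  note s' = bilinear_map_vector_spaces(2)[OF \<beta>]
  note lin = lin_intros s' bilinear_map_comp[OF \<beta>]
  let ?G = "\<lambda>q g h. sweedler s' (\<lambda>m n. \<beta> (g * S n) (h * S m)) q"
  have inner: "sweedler s' (\<lambda>p q. sweedler s' (\<lambda>z w. ?G q (u * z) (v * w)) p) y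
      = s' (\<epsilon> y) (\<beta> u v)" for u v y
  proof -
    have "sweedler s' (\<lambda>p q. sweedler s' (\<lambda>z w. ?G q (u * z) (v * w)) p) y
        = sweedler s' (\<lambda>z q. sweedler s' (\<lambda>w q. ?G q (u * z) (v * w)) q) y"
      by (rule sweedler_coassoc) (intro lin)+
    also have "\<dots> = sweedler s' (\<lambda>z q.
        sweedler s' (\<lambda>t n. sweedler s' (\<lambda>w m. \<beta> (u * z * S n) (v * w * S m)) t) q) y"
      by (subst sweedler_coassoc) (intro lin refl)+
    also have "\<dots> = sweedler s' (\<lambda>z q. sweedler s' (\<lambda>t n. s' (\<epsilon> t) (\<beta> (u * z * S n) (v * 1))) q) y"
      unfolding mult.assoc[of v] by (subst sweedler_antipode_right) (intro lin refl)+
    also have "\<dots> = sweedler s' (\<lambda>z q. \<beta> (u * z * S q) (v * 1)) y"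
      by (subst sweedler_counit_left) (intro lin refl)+
    also have "\<dots> = s' (\<epsilon> y) (\<beta> (u * 1) (v * 1))"
      unfolding mult.assoc[of u] by (rule sweedler_antipode_right) (intro lin)
    finally show ?thesis by simp
  qed
  have outer: "sweedler s' (\<lambda>x p. sweedler s' (\<lambda>u v. sweedler s' (\<lambda>z w. ?G q (u * z) (v * w)) p) (S x)) y
      = s' (\<epsilon> y) (?G q 1 1)" for q y
  proof -
    have bG: "bilinear_map scale s' (\<lambda>g h. ?G q g h)" by (intro lin)
    have "sweedler s' (\<lambda>u v. sweedler s' (\<lambda>z w. ?G q (u * z) (v * w)) p) (S x)
      = sweedler s' (\<lambda>g h. ?G q g h) (S x * p)" for x p
      by (rule sweedler_mult[OF bG, symmetric])
    moreover have "sweedler s' (\<lambda>x p. sweedler s' (\<lambda>g h. ?G q g h) (S x * p)) y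
       = s' (\<epsilon> y) (sweedler s' (\<lambda>g h. ?G q g h) 1)"
      by (rule sweedler_antipode_left) (intro lin)
    ultimately show ?thesis by (simp add: sweedler_one[OF bG])
  qed
  have "sweedler s' \<beta> (S a) = sweedler s' (\<lambda>x y. s' (\<epsilon> y) (sweedler s' \<beta> (S x))) a"
    by (rule sweedler_counit_right[symmetric]) (intro lin)
  also have "\<dots> = sweedler s' (\<lambda>x y. sweedler s' (\<lambda>u v. s' (\<epsilon> y) (\<beta> u v)) (S x)) a"
    by (subst linear_tensor2_lift[of s' s' "\<lambda>t. s' _ t"]) (intro lin refl)+
  also have "\<dots> = sweedler s' (\<lambda>x y. sweedler s' (\<lambda>u v.
      sweedler s' (\<lambda>p q. sweedler s' (\<lambda>z w. ?G q (u * z) (v * w)) p) y) (S x)) a"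
    by (simp only: inner)
  also have "\<dots> = sweedler s' (\<lambda>x y. sweedler s' (\<lambda>p q.
      sweedler s' (\<lambda>u v. sweedler s' (\<lambda>z w. ?G q (u * z) (v * w)) p) (S x)) y) a"
    by (subst tensor2_lift_commute) (intro lin refl)+
  also have "\<dots> = sweedler s' (\<lambda>y q. sweedler s' (\<lambda>x p.
      sweedler s' (\<lambda>u v. sweedler s' (\<lambda>z w. ?G q (u * z) (v * w)) p) (S x)) y) a"
    by (rule sweedler_coassoc[symmetric]) (intro lin)+
  also have "\<dots> = sweedler s' (\<lambda>y q. s' (\<epsilon> y) (?G q 1 1)) a"
    by (simp only: outer)
  also have "\<dots> = ?G a 1 1"
    by (rule sweedler_counit_left) (intro lin)
  finally show ?thesis by simp
qed

end

section \<open>The action of functionals\<close>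

context bialgebra
begin

definition convolution :: "('a \<Rightarrow> 'k) \<Rightarrow> ('a \<Rightarrow> 'k) \<Rightarrow> 'a \<Rightarrow> 'k"
  where "convolution f g a = sweedler (*) (\<lambda>x y. f x * g y) a"

abbreviation act :: "('a \<Rightarrow> 'k) \<Rightarrow> 'a \<Rightarrow> 'a"
  where "act \<equiv> left_act scale \<Delta>"

lemma act_linear:
  assumes "Vector_Spaces.linear scale (*) f"
  shows "Vector_Spaces.linear scale scale (act f)"
proof -
  have "bilinear_map scale scale (\<lambda>x y. scale (f y) x)"
    by (intro lin_intros linear_compose_lambda[OF assms])
  then show ?thesis using sweedler_linear by (simp add: left_act_def[abs_def])
qed

lemma act_sum: "act (\<lambda>x. \<Sum>i\<in>I. f i x) a = (\<Sum>i\<in>I. act (f i) a)"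
  unfolding left_act_def by (simp add: scale_sum_left tensor2_lift_sum[OF vector_space_axioms])

text \<open>
  The scalar \<open>c\<close> is carried along so that Kronecker deltas \<open>\<theta>\<^sub>i\<^sub>j(1)\<close> come out of the action.
\<close>

lemma act_counit: "act (\<lambda>x. \<epsilon> x * c) a = scale c a"
  unfolding left_act_def
  by (subst scale_scale[symmetric], rule sweedler_counit_right) (intro lin_intros)

lemma act_act:
  assumes f: "Vector_Spaces.linear scale (*) f" and g: "Vector_Spaces.linear scale (*) g"
  shows "act f (act g a) = act (convolution f g) a"
proof -
  note lin = lin_intros linear_compose_lambda[OF f] linear_compose_lambda[OF g]
  have scale_act: "scale c (act f x) = sweedler scale (\<lambda>p q. scale (f q * c) p) x" for c x
  proof -
    have "scale c (act f x) = sweedler scale (\<lambda>p q. scale c (scale (f q) p)) x"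
      unfolding left_act_def by (rule linear_tensor2_lift[where f = "scale c"]) (intro lin)
    then show ?thesis by (simp add: mult.commute)
  qed
  have "act f (act g a) = sweedler scale (\<lambda>x y. act f (scale (g y) x)) a"
    unfolding left_act_def[of scale \<Delta> g] by (rule linear_tensor2_lift[OF act_linear[OF f]])
  also have "\<dots> = sweedler scale (\<lambda>x y. sweedler scale (\<lambda>p q. scale (f q * g y) p) x) a"
    by (simp add: linD_scale[OF act_linear[OF f]] scale_act)
  also have "\<dots> = sweedler scale (\<lambda>x y. sweedler scale (\<lambda>p q. scale (f p * g q) x) y) a"
    by (rule sweedler_coassoc) (intro lin)+
  also have "\<dots> = act (convolution f g) a"
  proof -
    have "sweedler scale (\<lambda>p q. scale (f p * g q) x) y = scale (convolution f g y) x" for x y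
      unfolding convolution_def
      by (rule linear_tensor2_lift[where f = "\<lambda>t. scale t x", symmetric]) (intro lin)
    then show ?thesis by (simp add: left_act_def)
  qed
  finally show ?thesis .
qed

lemma sum_act_act:
  assumes "\<And>k. Vector_Spaces.linear scale (*) (f k)" "\<And>k. Vector_Spaces.linear scale (*) (g k)"
    and "\<And>x. (\<Sum>k\<in>K. convolution (f k) (g k) x) = \<epsilon> x * c"
  shows "(\<Sum>k\<in>K. act (f k) (act (g k) a)) = scale c a"
  by (simp add: act_act assms act_counit flip: act_sum)

text \<open>
  A functional that is a sum of products on products gives an operator of the same kind.
  This yields the multiplicativity of \<open>\<sigma>\<close> and \<open>\<sigma>bar\<close> and the twisted Leibniz rule of \<open>\<partial>\<close> at once.
\<close>

lemma act_mult:
  assumes f: "Vector_Spaces.linear scale (*) f"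
    and prod: "\<And>x y. f (x * y) = (\<Sum>k\<in>K. g k x * h k y)"
  shows "act f (a * b) = (\<Sum>k\<in>K. act (g k) a * act (h k) b)"
proof -
  have bil: "bilinear_map scale scale (\<lambda>x y. scale (f y) x)"
    by (intro lin_intros linear_compose_lambda[OF f])
  have step: "act g' a * act h' b
      = sweedler scale (\<lambda>x y. sweedler scale (\<lambda>z w. scale (g' y * h' w) (x * z)) b) a" for g' h'
  proof -
    have "act g' a * act h' b = sweedler scale (\<lambda>x y. scale (g' y) x * act h' b) a"
      unfolding left_act_def[of scale \<Delta> g'] by (rule linear_tensor2_lift) (intro lin_intros)
    also have "\<dots> = sweedler scale (\<lambda>x y. sweedler scale (\<lambda>z w. scale (g' y) x * scale (h' w) z) b) a"
    proof -
      have "t * act h' b = sweedler scale (\<lambda>z w. t * scale (h' w) z) b" for t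
        unfolding left_act_def by (rule linear_tensor2_lift[where f = "\<lambda>v. t * v"]) (intro lin_intros)
      then show ?thesis by simp
    qed
    finally show ?thesis by (simp add: scale_mult_left scale_mult_right mult.commute)
  qed
  have "act f (a * b) = sweedler scale (\<lambda>x y. sweedler scale (\<lambda>z w. scale (f (y * w)) (x * z)) b) a"
    unfolding left_act_def by (rule sweedler_mult[OF bil])
  also have "\<dots> = (\<Sum>k\<in>K. act (g k) a * act (h k) b)"
    by (simp add: prod step scale_sum_left tensor2_lift_sum[OF vector_space_axioms])
  finally show ?thesis .
qed

lemma act_one:
  assumes f: "Vector_Spaces.linear scale (*) f"
  shows "act f 1 = scale (f 1) 1"
  unfolding left_act_def by (rule sweedler_one) (intro lin_intros linear_compose_lambda[OF f])

text \<open>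
  By linearity \<open>l(a\<^sub>1) f(a\<^sub>2) = f(l(a\<^sub>1) a\<^sub>2) = f(l(a) 1)\<close>.
\<close>

lemma right_integral_act:
  assumes l: "right_integral scale \<Delta> l" and f: "Vector_Spaces.linear scale (*) f"
  shows "l (act f a) = l a * f 1"
proof -
  have lin_l: "Vector_Spaces.linear scale (*) l"
    and int: "sweedler scale (\<lambda>x y. scale (l x) y) a = scale (l a) 1"
    using l by (auto simp: right_integral_def)
  have "l (act f a) = sweedler (*) (\<lambda>x y. f y * l x) a"
    unfolding left_act_def by (simp add: linear_tensor2_lift[OF lin_l] linD_scale[OF lin_l])
  also have "\<dots> = f (sweedler scale (\<lambda>x y. scale (l x) y) a)"
    by (simp add: linear_tensor2_lift[OF f] linD_scale[OF f] mult.commute)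
  also have "\<dots> = l a * f 1" by (simp add: int linD_scale[OF f])
  finally show ?thesis .
qed

end

section \<open>The inverse of the antipode\<close>

locale hopf_algebra_bij = hopf_algebra scale \<Delta> \<epsilon> S
  for scale :: "'k::field \<Rightarrow> 'a::ring_1 \<Rightarrow> 'a" and \<Delta> and \<epsilon> and S +
  assumes bij_antipode: "bij S"
begin

abbreviation S' :: "'a \<Rightarrow> 'a" where "S' \<equiv> inv S"

lemma S_S' [simp]: "S (S' a) = a" and S'_S [simp]: "S' (S a) = a"
  using bij_antipode by (simp_all add: bij_is_surj surj_f_inv_f bij_is_inj)

lemma inverse_antipode_linear: "Vector_Spaces.linear scale scale S'"
proof -
  have "S' (x + y) = S' x + S' y" "S' (scale c x) = scale c (S' x)" for x y c
    using S'_S[of "S' x + S' y"] S'_S[of "scale c (S' x)"]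
    by (simp_all add: linD_add[OF antipode_linear] linD_scale[OF antipode_linear])
  then show ?thesis by (simp add: Vector_Spaces.linear_iff vector_space_axioms)
qed

lemma inverse_antipode_compose [lin_intros]:
  "Vector_Spaces.linear s scale g \<Longrightarrow> Vector_Spaces.linear s scale (\<lambda>x. S' (g x))"
  by (rule linear_compose_lambda[OF inverse_antipode_linear])

lemma inverse_antipode_mult: "S' (a * b) = S' b * S' a"
  using S'_S[of "S' b * S' a"] by (simp add: antipode_mult)

lemma inverse_antipode_one [simp]: "S' 1 = 1"
  using S'_S[of 1] by (simp add: antipode_one)

text \<open>
  Apply \<open>S\<inverse>\<close> to \<open>a\<^sub>1 S(a\<^sub>2) = \<epsilon>(a) 1\<close>; it reverses products.
\<close>

lemma sweedler_inverse_antipode_right: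
  assumes f: "Vector_Spaces.linear scale s' f"
  shows "sweedler s' (\<lambda>x y. f (y * S' x)) a = s' (\<epsilon> a) (f 1)"
proof -
  have "f (y * S' x) = f (S' (x * S y))" for x y by (simp add: inverse_antipode_mult)
  then show ?thesis
    using sweedler_antipode_right[OF linear_compose_lambda[OF f inverse_antipode_linear], of a]
    by simp
qed

lemma sweedler_inverse_antipode_left:
  assumes f: "Vector_Spaces.linear scale s' f"
  shows "sweedler s' (\<lambda>x y. f (S' y * x)) a = s' (\<epsilon> a) (f 1)"
proof -
  have "f (S' y * x) = f (S' (S x * y))" for x y by (simp add: inverse_antipode_mult)
  then show ?thesis
    using sweedler_antipode_left[OF linear_compose_lambda[OF f inverse_antipode_linear], of a]
    by simp
qed

lemma counit_antipode: "\<epsilon> (S a) = \<epsilon> a"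
proof -
  have "\<epsilon> (S a) = sweedler (*) (\<lambda>x y. \<epsilon> y * \<epsilon> (S x)) a"
    by (rule sweedler_counit_right[symmetric]) (intro lin_intros)
  also have "\<dots> = sweedler (*) (\<lambda>x y. \<epsilon> (S x * y)) a"
    by (simp add: counit_mult mult.commute)
  also have "\<dots> = \<epsilon> a * \<epsilon> 1"
    by (rule sweedler_antipode_left[OF counit_linear])
  finally show ?thesis by (simp add: counit_one)
qed

lemma counit_inverse_antipode [simp]: "\<epsilon> (S' a) = \<epsilon> a"
  using counit_antipode[of "S' a"] by simp

text \<open>
  The order of the coproduct is reversed twice, so \<open>S \<circ> S\<close> is a coalgebra map; the functional absorbs
  the inverse of \<open>S \<circ> S\<close> on the second factor.
\<close>

lemma antipode_square_act:
  assumes f: "Vector_Spaces.linear scale (*) f"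
  shows "S (S (act f a)) = act (f \<circ> (S' \<circ> S')) (S (S a))"
proof -
  note lin = lin_intros linear_compose_lambda[OF f]
  have "act (f \<circ> (S' \<circ> S')) (S (S a))
      = sweedler scale (\<lambda>x y. scale (f (S' (S' (S x)))) (S y)) (S a)"
    unfolding left_act_def comp_def by (rule sweedler_antipode) (intro lin)
  also have "\<dots> = sweedler scale (\<lambda>x y. scale (f (S' (S' (S (S y))))) (S (S x))) a"
    by (rule sweedler_antipode) (intro lin)
  also have "\<dots> = sweedler scale (\<lambda>x y. S (S (scale (f y) x))) a"
    by (simp add: linD_scale[OF antipode_linear])
  also have "\<dots> = S (S (act f a))"
    unfolding left_act_def by (rule linear_tensor2_lift[symmetric]) (intro lin)
  finally show ?thesis by simp
qed

end

section \<open>Twisted derivations from functionals\<close>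

locale hopf_twisted_derivation = hopf_algebra_bij scale \<Delta> \<epsilon> S
  for scale :: "'k::field \<Rightarrow> 'a::ring_1 \<Rightarrow> 'a" and \<Delta> and \<epsilon> and S +
  fixes \<theta> :: "'n::finite \<Rightarrow> 'n \<Rightarrow> 'a \<Rightarrow> 'k" and chi :: "'n \<Rightarrow> 'a \<Rightarrow> 'k"
  assumes \<theta>_linear: "Vector_Spaces.linear scale (*) (\<theta> i j)"
    and chi_linear: "Vector_Spaces.linear scale (*) (chi i)"
    and \<theta>_mult: "\<theta> i j (a * b) = (\<Sum>k\<in>UNIV. \<theta> i k a * \<theta> k j b)"
    and \<theta>_one: "\<theta> i j 1 = (if i = j then 1 else 0)"
    and chi_mult: "chi i (a * b) = (\<Sum>j\<in>UNIV. chi j a * \<theta> j i b) + \<epsilon> a * chi i b"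
begin

abbreviation "d \<equiv> \<lambda>i. act (chi i)"
abbreviation "\<sigma> \<equiv> \<lambda>i j. act (\<theta> i j)"
abbreviation "\<sigma>bar \<equiv> \<lambda>i j. act (\<theta> j i \<circ> S')"
abbreviation "\<sigma>hat \<equiv> \<lambda>i j. act (\<theta> i j \<circ> (S' \<circ> S'))"

lemmas functional_compose [lin_intros] =
  linear_compose_lambda[OF \<theta>_linear] linear_compose_lambda[OF chi_linear]

lemma functionals_linear:
  "Vector_Spaces.linear scale (*) (\<theta> i j \<circ> S')"
  "Vector_Spaces.linear scale (*) (\<theta> i j \<circ> (S' \<circ> S'))"
  "Vector_Spaces.linear scale (*) (chi i \<circ> S')"
  "Vector_Spaces.linear scale (*) (chi i \<circ> (S' \<circ> S'))"
  unfolding comp_def by (intro lin_intros)+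

lemmas linear_facts = \<theta>_linear chi_linear functionals_linear

lemma chi_one: "chi i 1 = 0"
proof -
  have "chi i 1 = (\<Sum>j\<in>UNIV. chi j 1 * \<theta> j i 1) + chi i 1"
    using chi_mult[of i 1 1] by (simp add: counit_one)
  also have "(\<Sum>j\<in>UNIV. chi j 1 * \<theta> j i 1) = chi i 1"
    by (simp add: \<theta>_one if_distrib sum.delta cong: if_cong)
  finally show ?thesis using add_cancel_right_left by blast
qed

lemma scale_\<theta>_one: "scale (\<theta> i j 1) a = (if i = j then a else 0)"
  by (simp add: \<theta>_one)

text \<open>
  In each of the four inverse relations the sum over \<open>k\<close> is a matrix product of values of \<open>\<theta>\<close>, hence
  a value of \<open>\<theta>\<close> on a product that the antipode relations reduce to \<open>\<epsilon>(x) 1\<close>.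
\<close>

lemma \<sigma>bar_\<sigma>: "(\<Sum>k\<in>UNIV. \<sigma>bar i k (\<sigma> j k a)) = (if i = j then a else 0)"
proof -
  have conv: "(\<Sum>k\<in>UNIV. convolution (\<theta> k i \<circ> S') (\<theta> j k) x) = \<epsilon> x * \<theta> j i 1" for x
    using sweedler_inverse_antipode_right[OF \<theta>_linear, of j i x]
    by (simp add: convolution_def \<theta>_mult mult.commute flip: tensor2_lift_sum[OF vector_space_field])
  show ?thesis
    using sum_act_act[of "\<lambda>k. \<theta> k i \<circ> S'" "\<lambda>k. \<theta> j k", OF _ _ conv]
    by (simp add: linear_facts scale_\<theta>_one eq_commute[of i j])
qed

lemma \<sigma>_\<sigma>bar: "(\<Sum>k\<in>UNIV. \<sigma> k i (\<sigma>bar k j a)) = (if i = j then a else 0)"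
proof -
  have conv: "(\<Sum>k\<in>UNIV. convolution (\<theta> k i) (\<theta> j k \<circ> S') x) = \<epsilon> x * \<theta> j i 1" for x
    using sweedler_inverse_antipode_left[OF \<theta>_linear, of j i x]
    by (simp add: convolution_def \<theta>_mult mult.commute flip: tensor2_lift_sum[OF vector_space_field])
  show ?thesis
    using sum_act_act[of "\<lambda>k. \<theta> k i" "\<lambda>k. \<theta> j k \<circ> S'", OF _ _ conv]
    by (simp add: linear_facts scale_\<theta>_one eq_commute[of i j])
qed

lemma \<sigma>hat_\<sigma>bar: "(\<Sum>k\<in>UNIV. \<sigma>hat i k (\<sigma>bar j k a)) = (if i = j then a else 0)"
proof -
  have conv: "(\<Sum>k\<in>UNIV. convolution (\<theta> i k \<circ> (S' \<circ> S')) (\<theta> k j \<circ> S') x) = \<epsilon> x * \<theta> i j 1" for x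
    using sweedler_inverse_antipode_right[OF functionals_linear(1), of i j x]
    by (simp add: convolution_def \<theta>_mult inverse_antipode_mult flip: tensor2_lift_sum[OF vector_space_field])
  show ?thesis
    using sum_act_act[of "\<lambda>k. \<theta> i k \<circ> (S' \<circ> S')" "\<lambda>k. \<theta> k j \<circ> S'", OF _ _ conv]
    by (simp add: linear_facts scale_\<theta>_one eq_commute[of i j])
qed

lemma \<sigma>bar_\<sigma>hat: "(\<Sum>k\<in>UNIV. \<sigma>bar k i (\<sigma>hat k j a)) = (if i = j then a else 0)"
proof -
  have conv: "(\<Sum>k\<in>UNIV. convolution (\<theta> i k \<circ> S') (\<theta> k j \<circ> (S' \<circ> S')) x) = \<epsilon> x * \<theta> i j 1" for x
    using sweedler_inverse_antipode_left[OF functionals_linear(1), of i j x]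
    by (simp add: convolution_def \<theta>_mult inverse_antipode_mult flip: tensor2_lift_sum[OF vector_space_field])
  show ?thesis
    using sum_act_act[of "\<lambda>k. \<theta> i k \<circ> S'" "\<lambda>k. \<theta> k j \<circ> (S' \<circ> S')", OF _ _ conv]
    by (simp add: linear_facts scale_\<theta>_one eq_commute[of i j])
qed

lemma \<sigma>bar_mult: "\<sigma>bar i j (a * b) = (\<Sum>k\<in>UNIV. \<sigma>bar i k a * \<sigma>bar k j b)"
  by (rule act_mult) (simp_all add: linear_facts inverse_antipode_mult \<theta>_mult mult.commute)

lemma \<sigma>bar_one: "\<sigma>bar i j 1 = (if i = j then 1 else 0)"
  by (simp add: act_one linear_facts \<theta>_one)

lemma d_mult: "d i (a * b) = (\<Sum>j\<in>UNIV. d j a * \<sigma> j i b) + a * d i b"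
proof -
  \<comment> \<open>The extra summand \<open>\<epsilon>(x) \<chi>\<^sub>i(y)\<close> is indexed by \<open>None\<close>.\<close>
  have "d i (a * b) = (\<Sum>k\<in>UNIV. act (case_option \<epsilon> chi k) a * act (case_option (chi i) (\<lambda>j. \<theta> j i) k) b)"
    by (rule act_mult) (simp_all add: linear_facts chi_mult UNIV_option_conv sum.reindex add.commute)
  moreover have "act \<epsilon> a = a"
    using act_counit[of 1 a] by simp
  ultimately show ?thesis by (simp add: UNIV_option_conv sum.reindex add.commute)
qed

lemma twisted_multi_derivation:
  "free_right_twisted_multi_derivation scale d \<sigma> \<sigma>bar \<sigma>hat"
  unfolding free_right_twisted_multi_derivation_def matrix_algebra_map_def
  by (intro conjI allI act_linear linear_facts act_mult \<theta>_mult \<sigma>bar_mult \<sigma>bar_one d_mult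
      \<sigma>bar_\<sigma> \<sigma>_\<sigma>bar \<sigma>hat_\<sigma>bar \<sigma>bar_\<sigma>hat) (simp add: act_one \<theta>_linear \<theta>_one)

section \<open>The twisted partial derivatives\<close>

text \<open>
  Apply \<open>\<chi>\<^sub>i\<close> to \<open>x\<^sub>2 S\<inverse>(x\<^sub>1) = \<epsilon>(x) 1\<close>, where \<open>\<chi>\<^sub>i(1) = 0\<close>.
\<close>

lemma chi_inverse_antipode:
  "chi i (S' x) = - (\<Sum>j\<in>UNIV. convolution (\<theta> j i \<circ> S') (chi j) x)"
proof -
  have "0 = \<epsilon> x * chi i 1" by (simp add: chi_one)
  also have "\<dots> = sweedler (*) (\<lambda>p q. chi i (q * S' p)) x"
    by (rule sweedler_inverse_antipode_right[OF chi_linear, symmetric])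
  also have "\<dots> = sweedler (*) (\<lambda>p q. \<epsilon> q * chi i (S' p) + (\<Sum>j\<in>UNIV. \<theta> j i (S' p) * chi j q)) x"
    by (simp add: chi_mult mult.commute add.commute)
  also have "\<dots> = sweedler (*) (\<lambda>p q. \<epsilon> q * chi i (S' p)) x + (\<Sum>j\<in>UNIV. convolution (\<theta> j i \<circ> S') (chi j) x)"
    by (simp add: tensor2_lift_add[OF vector_space_field] tensor2_lift_sum[OF vector_space_field] convolution_def)
  also have "sweedler (*) (\<lambda>p q. \<epsilon> q * chi i (S' p)) x = chi i (S' x)"
    by (rule sweedler_counit_right) (intro lin_intros)
  finally show ?thesis by (simp add: eq_neg_iff_add_eq_0 comp_def)
qed

text \<open>
  Apply \<open>\<chi>\<^sub>i\<close> to \<open>S\<inverse>(x\<^sub>1) S\<inverse>(S\<inverse>(x\<^sub>2)) = S\<inverse>(S\<inverse>(x\<^sub>2) x\<^sub>1) = \<epsilon>(x) 1\<close>.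
\<close>

lemma chi_inverse_antipode_square:
  "(\<Sum>k\<in>UNIV. convolution (chi k \<circ> S') (\<theta> k i \<circ> (S' \<circ> S')) x) = - chi i (S' (S' x))"
proof -
  have "0 = \<epsilon> x * chi i (S' 1)" by (simp add: chi_one)
  also have "\<dots> = sweedler (*) (\<lambda>p q. chi i (S' (S' q * p))) x"
    by (rule sweedler_inverse_antipode_left[symmetric]) (intro lin_intros)
  also have "\<dots> = sweedler (*) (\<lambda>p q. \<epsilon> (S' p) * chi i (S' (S' q)) + (\<Sum>k\<in>UNIV. chi k (S' p) * \<theta> k i (S' (S' q)))) x"
    by (simp add: inverse_antipode_mult chi_mult add.commute)
  also have "\<dots> = sweedler (*) (\<lambda>p q. \<epsilon> (S' p) * chi i (S' (S' q))) x + (\<Sum>k\<in>UNIV. convolution (chi k \<circ> S') (\<theta> k i \<circ> (S' \<circ> S')) x)"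
    by (simp add: tensor2_lift_add[OF vector_space_field] tensor2_lift_sum[OF vector_space_field] convolution_def)
  also have "sweedler (*) (\<lambda>p q. \<epsilon> (S' p) * chi i (S' (S' q))) x = chi i (S' (S' x))"
    unfolding counit_inverse_antipode by (rule sweedler_counit_left) (intro lin_intros)
  finally show ?thesis by (simp add: eq_neg_iff_add_eq_0 add.commute comp_def)
qed

text \<open>
  The sum over \<open>j\<close> is \<open>- (\<chi>\<^sub>k \<circ> S\<inverse>) \<triangleright>\<close> by \<open>chi_inverse_antipode\<close>; the sum over \<open>k\<close> then collapses by
  \<open>chi_inverse_antipode_square\<close>, and the two signs cancel.
\<close>

lemma twisted_partial_eq: "twisted_partial d \<sigma>bar \<sigma>hat i a = act (chi i \<circ> (S' \<circ> S')) a"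
proof -
  have neg: "act (\<lambda>x. - f x) b = - act f b" for f b
    unfolding left_act_def tensor2_lift_def lin_extend_def case_prod_unfold
    by (simp add: scale_minus_left scale_minus_right sum_negf)
  have "twisted_partial d \<sigma>bar \<sigma>hat i a = (\<Sum>k\<in>UNIV. \<Sum>j\<in>UNIV. \<sigma>bar k j (d j (\<sigma>hat k i a)))"
    unfolding twisted_partial_def by (rule sum.swap)
  also have "\<dots> = (\<Sum>k\<in>UNIV. act (\<lambda>x. - chi k (S' x)) (\<sigma>hat k i a))"
  proof -
    have "(\<Sum>j\<in>UNIV. \<sigma>bar k j (d j b)) = act (\<lambda>x. \<Sum>j\<in>UNIV. convolution (\<theta> j k \<circ> S') (chi j) x) b" for k b
      by (simp add: act_act linear_facts act_sum)
    then show ?thesis by (simp add: chi_inverse_antipode)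
  qed
  also have "\<dots> = - (\<Sum>k\<in>UNIV. act (chi k \<circ> S') (\<sigma>hat k i a))"
    by (simp add: neg sum_negf comp_def)
  also have "\<dots> = - act (\<lambda>x. \<Sum>k\<in>UNIV. convolution (chi k \<circ> S') (\<theta> k i \<circ> (S' \<circ> S')) x) a"
    by (simp add: act_act linear_facts act_sum)
  also have "\<dots> = act (chi i \<circ> (S' \<circ> S')) a"
    unfolding chi_inverse_antipode_square by (simp add: neg comp_def)
  finally show ?thesis .
qed

section \<open>The image of the divergence\<close>

text \<open>
  The right coordinates of a form: \<open>u = \<Sum>\<^sub>i \<omega>\<^sub>i v\<^sub>i\<close> with \<open>v\<^sub>i = \<Sum>\<^sub>j \<sigma>bar\<^sub>i\<^sub>j(u\<^sub>j)\<close>, because \<open>\<sigma>bar\<close> inverts the matrix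
  \<open>\<sigma>\<close> that moves scalars from the right of \<open>\<omega>\<^sub>i\<close> to its left.
\<close>

definition coordinate_form :: "'a \<Rightarrow> 'n \<Rightarrow> 'a ^ 'n \<Rightarrow> 'a"
  where "coordinate_form a i u = a * (\<Sum>j\<in>UNIV. \<sigma>bar i j (u $ j))"

lemma coordinate_form_hom: "coordinate_form a i \<in> form_hom \<sigma>"
proof -
  have add: "\<sigma>bar i j (x + y) = \<sigma>bar i j x + \<sigma>bar i j y" for j x y
    by (rule linD_add[OF act_linear[OF functionals_linear(1)]])
  have "(\<Sum>j\<in>UNIV. \<sigma>bar i j (\<Sum>l\<in>UNIV. u $ l * \<sigma> l j b)) = (\<Sum>m\<in>UNIV. \<sigma>bar i m (u $ m)) * b" for u :: "'a ^ 'n" and b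
  proof -
    have "(\<Sum>j\<in>UNIV. \<sigma>bar i j (\<Sum>l\<in>UNIV. u $ l * \<sigma> l j b))
        = (\<Sum>j\<in>UNIV. \<Sum>l\<in>UNIV. \<Sum>m\<in>UNIV. \<sigma>bar i m (u $ l) * \<sigma>bar m j (\<sigma> l j b))"
      by (simp add: linear_map_sum[OF act_linear[OF functionals_linear(1)]] \<sigma>bar_mult)
    also have "\<dots> = (\<Sum>l\<in>UNIV. \<Sum>m\<in>UNIV. \<Sum>j\<in>UNIV. \<sigma>bar i m (u $ l) * \<sigma>bar m j (\<sigma> l j b))"
      by (subst sum.swap, rule sum.cong[OF refl], rule sum.swap)
    also have "\<dots> = (\<Sum>l\<in>UNIV. \<Sum>m\<in>UNIV. \<sigma>bar i m (u $ l) * (if m = l then b else 0))"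
      by (simp only: \<sigma>bar_\<sigma> flip: sum_distrib_left)
    also have "\<dots> = (\<Sum>m\<in>UNIV. \<sigma>bar i m (u $ m)) * b"
      by (simp add: sum_distrib_right if_distrib cong: if_cong)
    finally show ?thesis .
  qed
  then show ?thesis
    by (simp add: form_hom_def coordinate_form_def form_right_act_def add sum.distrib distrib_left mult.assoc)
qed

lemma coordinate_form_axis: "coordinate_form a i (axis j 1) = (if j = i then a else 0)"
proof -
  have "(\<Sum>m\<in>UNIV. \<sigma>bar i m (axis j 1 $ m)) = (\<Sum>m\<in>UNIV. if m = j then \<sigma>bar i m 1 else 0)"
    using linD_scale[OF act_linear[OF functionals_linear(1)], of _ _ 0]
    by (intro sum.cong) (auto simp: axis_def)
  then show ?thesis by (simp add: coordinate_form_def \<sigma>bar_one)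
qed

lemma twisted_partial_add:
  "twisted_partial d \<sigma>bar \<sigma>hat i (a + b) = twisted_partial d \<sigma>bar \<sigma>hat i a + twisted_partial d \<sigma>bar \<sigma>hat i b"
  unfolding twisted_partial_eq by (rule linD_add[OF act_linear[OF functionals_linear(4)]])

lemma twisted_partial_zero: "twisted_partial d \<sigma>bar \<sigma>hat i 0 = 0"
  using twisted_partial_add[of i 0 0] by simp

lemma act_in_divergence_image: "act (chi i \<circ> (S' \<circ> S')) a \<in> divergence_image d \<sigma> \<sigma>bar \<sigma>hat"
proof -
  have "divergence d \<sigma>bar \<sigma>hat (coordinate_form a i) = (\<Sum>j\<in>UNIV. if j = i then twisted_partial d \<sigma>bar \<sigma>hat j a else 0)"
    unfolding divergence_def by (intro sum.cong) (auto simp: coordinate_form_axis twisted_partial_zero)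
  then have "act (chi i \<circ> (S' \<circ> S')) a = divergence d \<sigma>bar \<sigma>hat (coordinate_form a i)"
    by (simp add: twisted_partial_eq)
  then show ?thesis
    unfolding divergence_image_def using coordinate_form_hom by blast
qed

lemma divergence_image_add:
  assumes "x \<in> divergence_image d \<sigma> \<sigma>bar \<sigma>hat" "y \<in> divergence_image d \<sigma> \<sigma>bar \<sigma>hat"
  shows "x + y \<in> divergence_image d \<sigma> \<sigma>bar \<sigma>hat"
proof -
  obtain f g where f: "f \<in> form_hom \<sigma>" "x = divergence d \<sigma>bar \<sigma>hat f"
    and g: "g \<in> form_hom \<sigma>" "y = divergence d \<sigma>bar \<sigma>hat g"
    using assms by (auto simp: divergence_image_def)
  have "(\<lambda>u. f u + g u) \<in> form_hom \<sigma>"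
    using f(1) g(1) by (simp add: form_hom_def algebra_simps)
  moreover have "x + y = divergence d \<sigma>bar \<sigma>hat (\<lambda>u. f u + g u)"
    by (simp add: f g divergence_def twisted_partial_add sum.distrib)
  ultimately show ?thesis by (auto simp: divergence_image_def)
qed

lemma divergence_image_uminus:
  assumes "x \<in> divergence_image d \<sigma> \<sigma>bar \<sigma>hat"
  shows "- x \<in> divergence_image d \<sigma> \<sigma>bar \<sigma>hat"
proof -
  obtain f where f: "f \<in> form_hom \<sigma>" "x = divergence d \<sigma>bar \<sigma>hat f"
    using assms by (auto simp: divergence_image_def)
  have "(\<lambda>u. - f u) \<in> form_hom \<sigma>"
    using f(1) by (simp add: form_hom_def)
  moreover have "twisted_partial d \<sigma>bar \<sigma>hat i (- a) = - twisted_partial d \<sigma>bar \<sigma>hat i a" for i a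
    using twisted_partial_add[of i a "- a"] by (simp add: twisted_partial_zero eq_neg_iff_add_eq_0 add.commute)
  then have "- x = divergence d \<sigma>bar \<sigma>hat (\<lambda>u. - f u)"
    by (simp add: f divergence_def sum_negf)
  ultimately show ?thesis by (auto simp: divergence_image_def)
qed

text \<open>
  The cosets agree because the image of the divergence is a subgroup of \<open>A\<close>.
\<close>

lemma relative_integral_eq_zero:
  assumes x: "x \<in> divergence_image d \<sigma> \<sigma>bar \<sigma>hat"
  shows "relative_integral d \<sigma> \<sigma>bar \<sigma>hat x = coker_zero d \<sigma> \<sigma>bar \<sigma>hat"
proof -
  have "\<exists>z\<in>divergence_image d \<sigma> \<sigma>bar \<sigma>hat. y = x + z" if "y \<in> divergence_image d \<sigma> \<sigma>bar \<sigma>hat" for y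
    using divergence_image_add[OF that divergence_image_uminus[OF x]]
    by (intro bexI[of _ "y + - x"]) auto
  then show ?thesis
    unfolding relative_integral_def coker_zero_def elt_set_plus_def
    using divergence_image_add[OF x] by fastforce
qed

lemma antipode_square_d: "S (S (d i a)) = act (chi i \<circ> (S' \<circ> S')) (S (S a))"
  by (rule antipode_square_act[OF chi_linear])

lemma right_integral_act_chi:
  assumes "right_integral scale \<Delta> l"
  shows "l (act (chi i \<circ> (S' \<circ> S')) a) = 0"
  by (simp add: right_integral_act[OF assms functionals_linear(4)] chi_one)

end

theorem lemma3p4:
  fixes scale :: "'k::field \<Rightarrow> 'a::ring_1 \<Rightarrow> 'a"
    and \<Delta> :: "'a \<Rightarrow> ('a, 'k) tensor2"
    and \<epsilon> :: "'a \<Rightarrow> 'k"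
    and S :: "'a \<Rightarrow> 'a"
    and \<theta> :: "'n::finite \<Rightarrow> 'n \<Rightarrow> 'a \<Rightarrow> 'k"
    and chi :: "'n \<Rightarrow> 'a \<Rightarrow> 'k"
    and d :: "'n \<Rightarrow> 'a \<Rightarrow> 'a"
    and \<sigma> \<sigma>bar \<sigma>hat :: "'n \<Rightarrow> 'n \<Rightarrow> 'a \<Rightarrow> 'a"
  assumes "hopf_algebra scale \<Delta> \<epsilon> S"
    and "bij S"
    and "\<And>i j. Vector_Spaces.linear scale (*) (\<theta> i j)"
    and "\<And>i. Vector_Spaces.linear scale (*) (chi i)"
    and "\<And>i j a b. \<theta> i j (a * b) = (\<Sum>k\<in>UNIV. \<theta> i k a * \<theta> k j b)"
    and "\<And>i j. \<theta> i j 1 = (if i = j then 1 else 0)"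
    and "\<And>i a b. chi i (a * b) = (\<Sum>j\<in>UNIV. chi j a * \<theta> j i b) + \<epsilon> a * chi i b"
    and "\<And>i a. d i a = left_act scale \<Delta> (chi i) a"
    and "\<And>i j a. \<sigma> i j a = left_act scale \<Delta> (\<theta> i j) a"
    and "\<And>i j a. \<sigma>bar i j a = left_act scale \<Delta> (\<theta> j i \<circ> inv S) a"
    and "\<And>i j a. \<sigma>hat i j a = left_act scale \<Delta> (\<theta> i j \<circ> (inv S \<circ> inv S)) a"
  shows "free_right_twisted_multi_derivation scale d \<sigma> \<sigma>bar \<sigma>hat \<and>
    (\<forall>a i. relative_integral d \<sigma> \<sigma>bar \<sigma>hat (left_act scale \<Delta> (chi i \<circ> (inv S \<circ> inv S)) a)
             = relative_integral d \<sigma> \<sigma>bar \<sigma>hat (S (S (d i a))) \<and>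
           relative_integral d \<sigma> \<sigma>bar \<sigma>hat (S (S (d i a))) = coker_zero d \<sigma> \<sigma>bar \<sigma>hat) \<and>
    (\<forall>l. right_integral scale \<Delta> l \<longrightarrow>
      (\<forall>a i. l (left_act scale \<Delta> (chi i \<circ> (inv S \<circ> inv S)) a) = l (S (S (d i a))) \<and>
             l (S (S (d i a))) = 0))"
proof -
  interpret hopf_twisted_derivation scale \<Delta> \<epsilon> S \<theta> chi
    using assms(1-7)
    by (simp add: hopf_twisted_derivation_def hopf_twisted_derivation_axioms_def
        hopf_algebra_bij_def hopf_algebra_bij_axioms_def)
  have maps: "d = (\<lambda>i. left_act scale \<Delta> (chi i))"
    "\<sigma> = (\<lambda>i j. left_act scale \<Delta> (\<theta> i j))"
    "\<sigma>bar = (\<lambda>i j. left_act scale \<Delta> (\<theta> j i \<circ> inv S))"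
    "\<sigma>hat = (\<lambda>i j. left_act scale \<Delta> (\<theta> i j \<circ> (inv S \<circ> inv S)))"
    using assms(8-11) by (simp_all add: fun_eq_iff)
  show ?thesis
    unfolding maps antipode_square_d
    by (simp add: twisted_multi_derivation relative_integral_eq_zero act_in_divergence_image
        right_integral_act_chi)
qed

end
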